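(* There is a real $z\in[0,1]$ that is a dyadic density-one point but not a density-one point.
   Context: $\lambda$ is Lebesgue measure. For $\mathcal C\subseteq\mathbb R$, $\varrho(\mathcal C\mid z)=\liminf_{\gamma,\delta\to0^+}\frac{\lambda([z-\gamma,z+\delta]\cap\mathcal C)}{\gamma+\delta}$, and $\varrho_2(\mathcal C\mid z)=\liminf\frac{\lambda(I\cap\mathcal C)}{|I|}$ where $I$ ranges over basic dyadic intervals $[r2^{-n},(r+1)2^{-n}]$ containing $z$ with $|I|\to0$. $z$ is a density-one point if $\varrho(\mathcal C\mid z)=1$ for every effectively closed ($\Pi^0_1$) class $\mathcal C$ containing $z$; $z$ is a dyadic density-one point if $\varrho_2(\mathcal C\mid z)=1$ for every effectively closed class $\mathcal C$ containing $z$. *)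

theory Defs
  imports "HOL-Analysis.Analysis"
begin

text \<open>
  Codes for partial recursive functions. A code has no fixed arity: it denotes one partial
  function on tuples of each length (possibly the nowhere defined one). In \<open>PrimRec f g\<close> the
  recursion argument comes first and \<open>g\<close> receives the predecessor, the previous value and the
  parameters, in this order.
\<close>

datatype recf =
    Zero
  | Succ
  | Proj nat
  | Comp recf "recf list"
  | PrimRec recf recf
  | Mu recf

inductive rec_eval :: "recf \<Rightarrow> nat list \<Rightarrow> nat \<Rightarrow> bool" where
  eval_Zero: "rec_eval Zero xs 0"
| eval_Succ: "rec_eval Succ [x] (Suc x)"
| eval_Proj: "i < length xs \<Longrightarrow> rec_eval (Proj i) xs (xs ! i)"
| eval_Comp: "list_all2 (\<lambda>g y. rec_eval g xs y) gs ys \<Longrightarrow> rec_eval f ys z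
    \<Longrightarrow> rec_eval (Comp f gs) xs z"
| eval_PrimRec_0: "rec_eval f xs y \<Longrightarrow> rec_eval (PrimRec f g) (0 # xs) y"
| eval_PrimRec_Suc: "rec_eval (PrimRec f g) (n # xs) y \<Longrightarrow> rec_eval g (n # y # xs) z
    \<Longrightarrow> rec_eval (PrimRec f g) (Suc n # xs) z"
| eval_Mu: "rec_eval f (n # xs) 0 \<Longrightarrow> (\<And>i. i < n \<Longrightarrow> \<exists>y>0. rec_eval f (i # xs) y)
    \<Longrightarrow> rec_eval (Mu f) xs n"

text \<open>A \<open>k\<close>-ary relation, as a set of lists of length \<open>k\<close>, is computably enumerable if it is the
  domain of a \<open>k\<close>-ary partial recursive function.\<close>

definition computably_enumerable :: "nat \<Rightarrow> nat list set \<Rightarrow> bool" where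
  "computably_enumerable k A \<longleftrightarrow>
     (\<exists>f. A = {xs. length xs = k \<and> (\<exists>y. rec_eval f xs y)})"

definition rational_code :: "nat \<Rightarrow> nat \<Rightarrow> nat \<Rightarrow> real" where
  "rational_code a b c = (real a - real b) / real (Suc c)"

definition effectively_open :: "real set \<Rightarrow> bool" where
  "effectively_open U \<longleftrightarrow>
     (\<exists>A. computably_enumerable 6 A \<and>
        U = {x. \<exists>a b c a' b' c'. [a, b, c, a', b', c'] \<in> A \<and>
                 rational_code a b c < x \<and> x < rational_code a' b' c'})"

definition effectively_closed :: "real set \<Rightarrow> bool" where
  "effectively_closed C \<longleftrightarrow> effectively_open (- C)"

definition lower_density :: "real set \<Rightarrow> real \<Rightarrow> ereal" where
  "lower_density C z =
     Liminf (at_right 0 \<times>\<^sub>F at_right 0)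
       (\<lambda>(\<gamma>, \<delta>). ereal (measure lebesgue ({z - \<gamma> .. z + \<delta>} \<inter> C) / (\<gamma> + \<delta>)))"

definition dyadic_intervals :: "real set set" where
  "dyadic_intervals = {{real_of_int r / 2 ^ n .. (real_of_int r + 1) / 2 ^ n} | (r :: int) (n :: nat). True}"

text \<open>The filter expresses that \<open>I\<close> ranges over the basic dyadic intervals containing \<open>z\<close>
  and that the length of \<open>I\<close> tends to \<open>0\<close>.\<close>

definition lower_dyadic_density :: "real set \<Rightarrow> real \<Rightarrow> ereal" where
  "lower_dyadic_density C z =
     Liminf (inf (filtercomap (measure lebesgue) (at_right 0))
                 (principal {I \<in> dyadic_intervals. z \<in> I}))
       (\<lambda>I. ereal (measure lebesgue (I \<inter> C) / measure lebesgue I))"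

definition density_one_point :: "real \<Rightarrow> bool" where
  "density_one_point z \<longleftrightarrow>
     (\<forall>C. effectively_closed C \<and> z \<in> C \<longrightarrow> lower_density C z = 1)"

definition dyadic_density_one_point :: "real \<Rightarrow> bool" where
  "dyadic_density_one_point z \<longleftrightarrow>
     (\<forall>C. effectively_closed C \<and> z \<in> C \<longrightarrow> lower_dyadic_density C z = 1)"

end

theory Submission
  imports Defs
begin

text \<open>
  To the left of every dyadic rational \<open>q / 2 ^ n\<close> cut out the hole of length \<open>c ^ (n + 1)\<close>, where
  \<open>1/8 \<le> c \<le> 1/4\<close>, and let \<open>B c\<close> be the closed set that remains; it shrinks as \<open>c\<close> grows, and
  \<open>B (1/8)\<close> is effectively closed. A point of \<open>B (1/8)\<close> that infinitely often lies to the right of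
  \<open>q / 2 ^ n\<close> at distance less than \<open>(1/8) ^ (n + 1)\<close> is not a density-one point. A dyadic interval
  containing it need not notice the hole, as the hole lies on the other side of \<open>q / 2 ^ n\<close>. It
  can only notice holes at its own right end, but for a point of \<open>B d\<close> with \<open>d > c\<close> these are
  eventually much shorter than the interval, since \<open>(d / c) ^ n \<longrightarrow> \<infinity>\<close>; so \<open>B c\<close> has dyadic
  density one at every point of \<open>B d\<close> that is not a dyadic rational.

  Now force with pairs of an interval \<open>D\<close> and a parameter \<open>c\<close>, shrinking \<open>D\<close> and slightly increasing \<open>c\<close>
  in each step: for the next effectively closed class \<open>C\<close>, either some smaller \<open>D'\<close> misses \<open>C\<close>, or
  \<open>C\<close> contains \<open>B c \<inter> D\<close> up to dyadic rationals, and then \<open>C\<close> has dyadic density one at the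
  limit point because this point also lies in \<open>B d\<close> for a later parameter \<open>d > c\<close>.
\<close>

section \<open>Arithmetic of partial recursive codes\<close>

text \<open>This makes the effectively closed classes countable, so that they can be handled one at
  a time.\<close>

instance recf :: countable
  by countable_datatype

lemma rec_eval_functional:
  assumes "rec_eval f xs y" "rec_eval f xs z"
  shows "y = z"
  using assms
proof (induction arbitrary: z rule: rec_eval.induct)
  case (eval_Comp xs gs ys f w)
  from eval_Comp.prems obtain ys' where ys': "list_all2 (\<lambda>g y. rec_eval g xs y) gs ys'"
    and f: "rec_eval f ys' z"
    by (cases rule: rec_eval.cases) auto
  have "ys = ys'"
    using eval_Comp.IH(1) ys' by (auto simp: list_all2_conv_all_nth intro!: nth_equalityI)
  then show ?case
    using eval_Comp.IH(2) f by simp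
next
  case (eval_PrimRec_0 f xs y g)
  from eval_PrimRec_0.prems show ?case
    by (cases rule: rec_eval.cases) (auto intro: eval_PrimRec_0.IH)
next
  case (eval_PrimRec_Suc f g n xs y w)
  from eval_PrimRec_Suc.prems show ?case
    by (cases rule: rec_eval.cases) (auto dest: eval_PrimRec_Suc.IH)
next
  case (eval_Mu f n xs)
  from eval_Mu.prems have z: "rec_eval f (z # xs) 0" and lt: "\<And>i. i < z \<Longrightarrow> \<exists>y>0. rec_eval f (i # xs) y"
    by (cases rule: rec_eval.cases; auto)+
  show ?case
  proof (rule linorder_cases)
    assume "n < z"
    then show ?thesis using lt eval_Mu.IH(1) by blast
  next
    assume "z < n"
    then show ?thesis using z eval_Mu.IH(2) by blast
  qed
qed (auto elim: rec_eval.cases)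

text \<open>This presents a condition "some n solves a computable equation" as the domain of a code.
  The search reaches the least zero because \<open>f\<close> is total and single-valued
  there.\<close>

lemma rec_eval_Mu_iff:
  assumes "\<And>n. rec_eval f (n # xs) (F n)"
  shows "(\<exists>y. rec_eval (Mu f) xs y) \<longleftrightarrow> (\<exists>n. F n = 0)"
proof
  assume "\<exists>y. rec_eval (Mu f) xs y"
  then obtain n where "rec_eval f (n # xs) 0"
    by (auto elim: rec_eval.cases)
  then show "\<exists>n. F n = 0"
    using assms rec_eval_functional by blast
next
  assume ex: "\<exists>n. F n = 0"
  define n where "n = (LEAST n. F n = 0)"
  have "F n = 0"
    using ex unfolding n_def by (rule LeastI_ex)
  moreover have "F i > 0" if "i < n" for i
    using not_less_Least[OF that[unfolded n_def]] by simp
  ultimately have "rec_eval (Mu f) xs n"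
    using assms by (metis eval_Mu)
  then show "\<exists>y. rec_eval (Mu f) xs y" ..
qed

lemma rec_eval_Comp1:
  "rec_eval g xs y \<Longrightarrow> rec_eval f [y] z \<Longrightarrow> rec_eval (Comp f [g]) xs z"
  by (rule eval_Comp[where ys = "[y]"]) auto

lemma rec_eval_Comp2:
  "rec_eval g xs y \<Longrightarrow> rec_eval h xs y' \<Longrightarrow> rec_eval f [y, y'] z \<Longrightarrow> rec_eval (Comp f [g, h]) xs z"
  by (rule eval_Comp[where ys = "[y, y']"]) auto

lemma rec_eval_Proj: "i < length xs \<Longrightarrow> xs ! i = y \<Longrightarrow> rec_eval (Proj i) xs y"
  using eval_Proj by auto

section \<open>Codes for elementary arithmetic\<close>

definition rec_add :: recf where
  "rec_add = PrimRec (Proj 0) (Comp Succ [Proj 1])"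

lemma rec_eval_add: "rec_eval rec_add [x, y] (x + y)"
proof (induction x)
  case 0
  show ?case
    unfolding rec_add_def by (auto intro!: eval_PrimRec_0 rec_eval_Proj)
next
  case (Suc x)
  have "rec_eval (Comp Succ [Proj 1]) [x, x + y, y] (Suc (x + y))"
    by (rule rec_eval_Comp1[OF rec_eval_Proj eval_Succ]) auto
  then show ?case
    using eval_PrimRec_Suc Suc unfolding rec_add_def by fastforce
qed

definition rec_mult :: recf where
  "rec_mult = PrimRec Zero (Comp rec_add [Proj 1, Proj 2])"

lemma rec_eval_mult: "rec_eval rec_mult [x, y] (x * y)"
proof (induction x)
  case 0
  show ?case
    unfolding rec_mult_def by (auto intro!: eval_PrimRec_0 eval_Zero)
next
  case (Suc x)
  have "rec_eval (Comp rec_add [Proj 1, Proj 2]) [x, x * y, y] (x * y + y)"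
    by (rule rec_eval_Comp2[OF rec_eval_Proj rec_eval_Proj rec_eval_add]) auto
  then show ?case
    using eval_PrimRec_Suc Suc unfolding rec_mult_def by (fastforce simp: add.commute)
qed

definition rec_pred :: recf where
  "rec_pred = PrimRec Zero (Proj 0)"

lemma rec_eval_pred: "rec_eval rec_pred [x] (x - 1)"
proof (induction x)
  case 0
  show ?case
    unfolding rec_pred_def by (auto intro!: eval_PrimRec_0 eval_Zero)
next
  case (Suc x)
  then show ?case
    unfolding rec_pred_def by (auto intro!: rec_eval_Proj intro: eval_PrimRec_Suc)
qed

definition rec_sub :: recf where
  "rec_sub = PrimRec (Proj 0) (Comp rec_pred [Proj 1])"

lemma rec_eval_sub: "rec_eval rec_sub [x, y] (y - x)"
proof (induction x)
  case 0
  show ?case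
    unfolding rec_sub_def by (auto intro!: eval_PrimRec_0 rec_eval_Proj)
next
  case (Suc x)
  have "rec_eval (Comp rec_pred [Proj 1]) [x, y - x, y] (y - x - 1)"
    by (rule rec_eval_Comp1[OF rec_eval_Proj rec_eval_pred]) auto
  then show ?case
    using eval_PrimRec_Suc Suc unfolding rec_sub_def by fastforce
qed

text \<open>This is |x - y| in truncated arithmetic. It vanishes exactly for equal arguments, so
  equations become zeros that \<open>Mu\<close> can search for.\<close>

definition rec_dist :: recf where
  "rec_dist = Comp rec_add [rec_sub, Comp rec_sub [Proj 1, Proj 0]]"

lemma rec_eval_dist: "rec_eval rec_dist [x, y] ((y - x) + (x - y))"
  unfolding rec_dist_def
  by (rule rec_eval_Comp2[OF rec_eval_sub rec_eval_Comp2[OF rec_eval_Proj rec_eval_Proj rec_eval_sub]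
        rec_eval_add]) auto

definition rec_pow2 :: recf where
  "rec_pow2 = PrimRec (Comp Succ [Zero]) (Comp rec_add [Proj 1, Proj 1])"

lemma rec_eval_pow2: "rec_eval rec_pow2 [x] (2 ^ x)"
proof (induction x)
  case 0
  have "rec_eval (Comp Succ [Zero]) [] 1"
    using rec_eval_Comp1[OF eval_Zero eval_Succ] by simp
  then show ?case
    unfolding rec_pow2_def by (auto intro!: eval_PrimRec_0)
next
  case (Suc x)
  have "rec_eval (Comp rec_add [Proj 1, Proj 1]) [x, 2 ^ x] (2 ^ x + 2 ^ x)"
    by (rule rec_eval_Comp2[OF rec_eval_Proj rec_eval_Proj rec_eval_add]) auto
  then show ?case
    using eval_PrimRec_Suc Suc unfolding rec_pow2_def by (fastforce simp: mult_2)
qed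

section \<open>Holes to the left of dyadic rationals\<close>

text \<open>The exponent \<open>Suc n\<close> shortens the holes of level 0 too: for c = 1/4 those
  with right endpoint in (j, j + 1], j an integer, have total length 1/2, the sum of 2^n /
  4^(n+1).\<close>

definition hole :: "real \<Rightarrow> nat \<Rightarrow> int \<Rightarrow> real set" where
  "hole c n q = {real_of_int q / 2 ^ n - c ^ Suc n <..< real_of_int q / 2 ^ n}"

definition holes :: "real \<Rightarrow> real set" where
  "holes c = (\<Union>n q. hole c n q)"

definition dyadic_rationals :: "real set" where
  "dyadic_rationals = {real_of_int q / 2 ^ n | (q :: int) (n :: nat). True}"

definition cell :: "nat \<Rightarrow> int \<Rightarrow> real set" where
  "cell m r = {real_of_int r / 2 ^ m .. (real_of_int r + 1) / 2 ^ m}"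

lemma dyadic_rationalsI: "real_of_int q / 2 ^ n \<in> dyadic_rationals"
  by (auto simp: dyadic_rationals_def)

lemma countable_dyadic_rationals: "countable dyadic_rationals"
proof -
  have eq: "dyadic_rationals = range (\<lambda>(q :: int, n :: nat). real_of_int q / 2 ^ n)"
    by (auto simp: dyadic_rationals_def)
  show ?thesis
    unfolding eq by (intro countable_image countableI_type)
qed

lemma open_holes: "open (holes c)"
  unfolding holes_def hole_def by (intro open_UN ballI open_greaterThanLessThan)

lemma holes_mono:
  assumes "0 \<le> c" "c \<le> d"
  shows "holes c \<subseteq> holes d"
proof -
  have "hole c n q \<subseteq> hole d n q" for n q
    using power_mono[OF assms(2,1), of "Suc n"] by (auto simp: hole_def)
  then show ?thesis
    unfolding holes_def by fast
qed

text \<open>As l \<le> n, both fractions lie on the grid of level n, whose distinct points are at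
  least 2^-n apart.\<close>

lemma dyadic_gap:
  assumes "l \<le> n" "real_of_int q / 2 ^ n < real_of_int s / 2 ^ l"
  shows "(real_of_int q + 1) / 2 ^ n \<le> real_of_int s / 2 ^ l"
proof -
  have eq: "real_of_int s / 2 ^ l = real_of_int (s * 2 ^ (n - l)) / 2 ^ n"
  proof -
    have "(2::real) ^ n = 2 ^ l * 2 ^ (n - l)"
      using assms(1) by (metis le_add_diff_inverse power_add)
    then show ?thesis by simp
  qed
  have "real_of_int q < real_of_int (s * 2 ^ (n - l))"
    using assms(2) unfolding eq by (simp add: divide_less_cancel del: of_int_mult)
  then have "q + 1 \<le> s * 2 ^ (n - l)"
    by linarith
  then have "real_of_int q + 1 \<le> real_of_int (s * 2 ^ (n - l))"
    by linarith
  then show ?thesis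
    unfolding eq by (simp add: divide_right_mono del: of_int_mult)
qed

text \<open>One factor \<open>1 / 2 ^ n\<close> pays for the 2^n holes of level n per unit length,
  the other makes the sum over the levels converge.\<close>

lemma power_quarter_le:
  assumes "0 \<le> c" "c \<le> (1/4 :: real)"
  shows "c ^ Suc n \<le> 1 / 2 ^ n / 2 ^ n / 4"
proof -
  have "c ^ Suc n \<le> (1/4) ^ Suc n"
    using assms by (intro power_mono)
  also have "(1/4 :: real) ^ n = (1/2) ^ n * (1/2) ^ n"
    by (simp flip: power_mult_distrib)
  then have "(1/4 :: real) ^ Suc n = 1 / 2 ^ n / 2 ^ n / 4"
    by (simp add: power_one_over)
  finally show ?thesis .
qed

text \<open>A hole of level at least \<open>m\<close> is shorter than the grid of its level, so that a cell of level \<open>m\<close>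
  meets only those whose right endpoint it contains.\<close>

lemma emeasure_fine_holes:
  assumes "0 \<le> c" "c \<le> 1/4"
  shows "emeasure lborel (cell m r \<inter> (\<Union>n\<in>{m..}. \<Union>q. hole c n q)) \<le> ennreal (1 / 2 ^ m / 2 ^ m / 2)"
proof -
  \<comment> \<open>These are the 2^j right endpoints of level m + j in the cell. The left end of
    the cell is left out, as its hole lies to the left of the cell.\<close>
  define Q where "Q j = {r * 2 ^ j <.. (r + 1) * 2 ^ j}" for j :: nat
  define A where "A j = (\<Union>q\<in>Q j. hole c (m + j) q)" for j
  have meas: "hole c n q \<in> sets lborel" for n q
    by (simp add: hole_def)
  have "cell m r \<inter> (\<Union>n\<in>{m..}. \<Union>q. hole c n q) \<subseteq> (\<Union>j. A j)"
  proof
    fix x assume "x \<in> cell m r \<inter> (\<Union>n\<in>{m..}. \<Union>q. hole c n q)"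
    then obtain n q where x: "x \<in> cell m r" "x \<in> hole c n q" and "m \<le> n" by auto
    then obtain j where n: "n = m + j" using le_Suc_ex by blast
    have e: "real_of_int s / 2 ^ m = real_of_int (s * 2 ^ j) / 2 ^ n" for s
      by (simp add: n power_add)
    have "real_of_int r / 2 ^ m < real_of_int q / 2 ^ n"
      using x by (auto simp: cell_def hole_def)
    then have "r * 2 ^ j < q"
      unfolding e by (simp add: divide_less_cancel del: of_int_mult)
    \<comment> \<open>A grid point beyond the cell is at least one step of level n beyond it, and no
      hole of that level is longer than one step.\<close>
    moreover have "q \<le> (r + 1) * 2 ^ j"
    proof (rule ccontr)
      assume "\<not> ?thesis"
      then have "real_of_int ((r + 1) * 2 ^ j) / 2 ^ n < real_of_int q / 2 ^ n"
        by (simp add: divide_less_cancel del: of_int_mult)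
      then have "real_of_int (r + 1) / 2 ^ m + 1 / 2 ^ n \<le> real_of_int q / 2 ^ n"
        using dyadic_gap[of n n "(r + 1) * 2 ^ j" q] unfolding e by (simp add: add_divide_distrib)
      moreover have "c ^ Suc n \<le> 1 / 2 ^ n"
      proof -
        have "1 \<le> 4 * (2::real) ^ n"
          using one_le_power[of "2::real" n] by linarith
        then have "1 / 2 ^ n / 2 ^ n / 4 \<le> 1 / (2 ^ n :: real)"
          by (simp add: field_simps)
        then show ?thesis using power_quarter_le[OF assms, of n] by linarith
      qed
      ultimately show False
        using x by (auto simp: cell_def hole_def)
    qed
    ultimately show "x \<in> (\<Union>j. A j)"
      using x(2) unfolding A_def Q_def n by (meson UN_I UNIV_I greaterThanAtMost_iff)
  qed
  then have "emeasure lborel (cell m r \<inter> (\<Union>n\<in>{m..}. \<Union>q. hole c n q)) \<le> emeasure lborel (\<Union>j. A j)"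
    using meas by (intro emeasure_mono) (auto simp: A_def Q_def)
  also have "\<dots> \<le> (\<Sum>j. emeasure lborel (A j))"
    using meas by (intro emeasure_subadditive_countably) (auto simp: A_def Q_def)
  \<comment> \<open>Level m + j contributes 2^j holes of length at most 4^-(m+j+1), hence a
    geometric series of ratio 1/2.\<close>
  also have "\<dots> \<le> (\<Sum>j. ennreal (1 / 2 ^ m / 2 ^ m / 4 * (1/2) ^ j))"
  proof (rule suminf_le)
    fix j
    have "emeasure lborel (A j) \<le> (\<Sum>q\<in>Q j. emeasure lborel (hole c (m + j) q))"
      unfolding A_def using meas by (intro emeasure_subadditive_finite) (auto simp: Q_def)
    also have "\<dots> = (\<Sum>q\<in>Q j. ennreal (c ^ Suc (m + j)))"
      using assms by (simp add: hole_def)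
    also have "\<dots> = ennreal (2 ^ j * c ^ Suc (m + j))"
      using assms by (simp add: Q_def ring_distribs ennreal_mult ennreal_of_nat_eq_real_of_nat nat_power_eq flip: ennreal_power)
    also have "\<dots> \<le> ennreal (1 / 2 ^ m / 2 ^ m / 4 * (1/2) ^ j)"
    proof (rule ennreal_leI)
      have "2 ^ j * c ^ Suc (m + j) \<le> 2 ^ j * (1 / 2 ^ (m + j) / 2 ^ (m + j) / 4)"
        by (intro mult_left_mono power_quarter_le assms) simp
      then show "2 ^ j * c ^ Suc (m + j) \<le> 1 / 2 ^ m / 2 ^ m / 4 * (1/2) ^ j"
        by (simp add: power_add power_one_over)
    qed
    finally show "emeasure lborel (A j) \<le> ennreal (1 / 2 ^ m / 2 ^ m / 4 * (1/2) ^ j)" .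
  qed auto
  also have "\<dots> = ennreal (1 / 2 ^ m / 2 ^ m / 2)"
  proof (rule suminf_ennreal_eq)
    show "(\<lambda>j. 1 / 2 ^ m / 2 ^ m / 4 * (1/2) ^ j) sums (1 / 2 ^ m / 2 ^ m / (2::real))"
      using sums_mult[OF geometric_sums[of "1/2 :: real"], of "1 / 2 ^ m / 2 ^ m / 4"] by (simp add: mult_ac)
  qed simp
  finally show ?thesis .
qed

text \<open>By measure: holes of level at least m fill at most the fraction 2^-m / 2 of the cell,
  the coarser ones miss it by assumption, and the dyadic rationals are null.\<close>

lemma exists_point_outside_holes:
  assumes c: "0 \<le> c" "c \<le> 1/4" and coarse: "\<And>n q. n < m \<Longrightarrow> cell m r \<inter> hole c n q = {}"
  shows "\<exists>y\<in>{real_of_int r / 2 ^ m <..< (real_of_int r + 1) / 2 ^ m}. y \<notin> holes c \<and> y \<notin> dyadic_rationals"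
proof (rule ccontr)
  let ?F = "cell m r \<inter> (\<Union>n\<in>{m..}. \<Union>q. hole c n q)"
  assume neg: "\<not> ?thesis"
  have "{real_of_int r / 2 ^ m <..< (real_of_int r + 1) / 2 ^ m} \<subseteq> ?F \<union> dyadic_rationals"
  proof
    fix y assume y: "y \<in> {real_of_int r / 2 ^ m <..< (real_of_int r + 1) / 2 ^ m}"
    then have "y \<in> cell m r" by (simp add: cell_def)
    moreover from this have "\<not> n < m" if "y \<in> hole c n q" for n q
      using coarse that by blast
    ultimately show "y \<in> ?F \<union> dyadic_rationals"
      using neg y unfolding holes_def by (force simp: not_less)
  qed
  moreover have D: "dyadic_rationals \<in> null_sets lborel" and F: "?F \<in> sets lborel"
    by (auto simp: cell_def hole_def intro: countable_imp_null_set_lborel countable_dyadic_rationals)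
  ultimately have "emeasure lborel {real_of_int r / 2 ^ m <..< (real_of_int r + 1) / 2 ^ m} \<le> emeasure lborel (?F \<union> dyadic_rationals)"
    by (meson emeasure_mono sets.Un null_setsD2)
  also have "emeasure lborel (?F \<union> dyadic_rationals) = emeasure lborel ?F"
    using F D by (rule emeasure_Un_null_set)
  also have "\<dots> \<le> ennreal (1 / 2 ^ m / 2 ^ m / 2)"
    by (rule emeasure_fine_holes[OF c])
  also have "emeasure lborel {real_of_int r / 2 ^ m <..< (real_of_int r + 1) / 2 ^ m} = ennreal (1 / 2 ^ m)"
    by (simp add: divide_right_mono flip: diff_divide_distrib)
  finally have "1 / 2 ^ m \<le> 1 / 2 ^ m / 2 ^ m / (2::real)"
    by (simp add: ennreal_le_iff)
  moreover have "1 / 2 ^ m / 2 ^ m / (2::real) < 1 / 2 ^ m"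
  proof -
    have "(1::real) < 2 ^ m * 2" using one_le_power[of "2::real" m] by linarith
    then show ?thesis by (simp add: field_simps)
  qed
  ultimately show False by simp
qed

text \<open>Holes of level at least m take up at most 4^-m / 2 of a cell of level m. A coarser hole
  meeting the cell of z ends at or beyond the right end of the cell. Widened from c to d it still
  does not contain z, so the widening is below 2^-m. This forces a high level, where the length
  c^(n+1) is a small fraction of the widening.\<close>

lemma holes_density:
  assumes c: "0 < c" "c < d" "d \<le> 1/4" and z: "z \<notin> holes d" "z \<notin> dyadic_rationals" and "\<epsilon> > 0"
  shows "\<exists>m\<^sub>0. \<forall>m\<ge>m\<^sub>0. \<forall>r. z \<in> cell m r \<longrightarrow> emeasure lborel (cell m r \<inter> holes c) \<le> ennreal (\<epsilon> / 2 ^ m)"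
proof -
  have "1 < d / c" using c by simp
  \<comment> \<open>From level N on, the widening d^(n+1) - c^(n+1) is at least 2 / \<epsilon> times
    the length c^(n+1).\<close>
  then obtain N where N: "2 / \<epsilon> + 1 < (d / c) ^ N"
    using real_arch_pow by blast
  have ratio: "2 / \<epsilon> * c ^ Suc n \<le> d ^ Suc n - c ^ Suc n" if "N \<le> n" for n
  proof -
    have "2 / \<epsilon> + 1 \<le> (d / c) ^ Suc n"
      using N power_increasing[of N "Suc n" "d / c"] that \<open>1 < d / c\<close> by simp
    then show ?thesis
      using c by (simp add: power_divide field_simps)
  qed
  \<comment> \<open>Below level N the widening has a fixed positive lower bound. The choice of
    \<open>m\<^sub>1\<close> makes the cells shorter than it, which excludes coarse holes of these
    levels.\<close>
  have diff: "(d - c) * d ^ N \<le> d ^ Suc n - c ^ Suc n" if "n < N" for n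
  proof -
    have "(d - c) * d ^ N \<le> (d - c) * d ^ n"
      using c that by (intro mult_left_mono power_decreasing) auto
    moreover have "c * c ^ n \<le> c * d ^ n"
      using c by (intro mult_left_mono power_mono) auto
    ultimately show ?thesis
      by (simp add: algebra_simps)
  qed
  obtain m\<^sub>1 where m1: "(1/2) ^ m\<^sub>1 < (d - c) * d ^ N"
    using real_arch_pow_inv[of "(d - c) * d ^ N" "1/2"] c by auto
  obtain m\<^sub>2 where m2: "(1/2) ^ m\<^sub>2 < \<epsilon>"
    using real_arch_pow_inv[of \<epsilon> "1/2"] \<open>\<epsilon> > 0\<close> by auto
  have "emeasure lborel (cell m r \<inter> holes c) \<le> ennreal (\<epsilon> / 2 ^ m)"
    if m: "m \<ge> max m\<^sub>1 m\<^sub>2" and zr: "z \<in> cell m r" for m r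
  proof -
    define e where "e = (real_of_int r + 1) / 2 ^ m"
    let ?F = "cell m r \<inter> (\<Union>n\<in>{m..}. \<Union>q. hole c n q)"
    have em: "real_of_int r / 2 ^ m = e - 1 / 2 ^ m"
      by (simp add: e_def add_divide_distrib)
    \<comment> \<open>Strictness matters: with z < e \<le> t, avoiding the widened hole puts z at or
      before its left end.\<close>
    have "z \<noteq> e"
      using z(2) dyadic_rationalsI[of "r + 1" m] by (auto simp: e_def)
    then have ze: "z < e" "e - 1 / 2 ^ m \<le> z"
      using zr em by (auto simp: cell_def e_def)
    have small: "1 / 2 ^ m < (d - c) * d ^ N" "1 / 2 ^ m < \<epsilon>"
      using m m1 m2 power_decreasing[of m\<^sub>1 m "1/2 :: real"] power_decreasing[of m\<^sub>2 m "1/2 :: real"]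
      by (auto simp: power_one_over)
    have coarse: "e - \<epsilon> / 2 / 2 ^ m \<le> x" if n: "n < m" and x: "x \<in> cell m r" "x \<in> hole c n q" for n q x
    proof -
      define t where "t = real_of_int q / 2 ^ n"
      have "real_of_int r / 2 ^ m < t" "x \<le> e" and xt: "t - c ^ Suc n < x"
        using x by (auto simp: cell_def hole_def e_def t_def)
      \<comment> \<open>No dyadic rational of level n < m lies strictly inside a cell of level
        m.\<close>
      then have et: "e \<le> t"
        using dyadic_gap[of n m r q] n by (auto simp: e_def t_def)
      have "z \<notin> hole d n q"
        using z(1) by (auto simp: holes_def)
      then have "z \<le> t - d ^ Suc n"
        using ze(1) et by (auto simp: hole_def t_def)
      then have d: "d ^ Suc n - c ^ Suc n < 1 / 2 ^ m"
        using xt \<open>x \<le> e\<close> ze(2) by linarith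
      then have "N \<le> n"
        using diff[of n] small(1) by (meson less_le_trans not_less less_asym)
      then have "2 / \<epsilon> * c ^ Suc n \<le> 1 / 2 ^ m"
        using ratio d by force
      then have "c ^ Suc n \<le> \<epsilon> / 2 / 2 ^ m"
        using \<open>\<epsilon> > 0\<close> by (simp add: field_simps)
      then show ?thesis
        using xt et by linarith
    qed
    have "cell m r \<inter> holes c \<subseteq> {e - \<epsilon> / 2 / 2 ^ m .. e} \<union> ?F"
    proof
      fix x assume "x \<in> cell m r \<inter> holes c"
      then obtain n q where x: "x \<in> cell m r" "x \<in> hole c n q"
        by (auto simp: holes_def)
      then show "x \<in> {e - \<epsilon> / 2 / 2 ^ m .. e} \<union> ?F"
        using coarse[OF _ x] by (cases "n < m") (auto simp: cell_def e_def not_less)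
    qed
    then have "emeasure lborel (cell m r \<inter> holes c) \<le> emeasure lborel ({e - \<epsilon> / 2 / 2 ^ m .. e} \<union> ?F)"
      by (intro emeasure_mono) (auto simp: cell_def hole_def)
    also have "\<dots> \<le> emeasure lborel {e - \<epsilon> / 2 / 2 ^ m .. e} + emeasure lborel ?F"
      by (intro emeasure_subadditive) (auto simp: cell_def hole_def)
    also have "\<dots> \<le> ennreal (\<epsilon> / 2 / 2 ^ m) + ennreal (\<epsilon> / 2 / 2 ^ m)"
    proof (rule add_mono)
      have "1 / 2 ^ m / 2 ^ m / 2 \<le> \<epsilon> / 2 / 2 ^ m"
        using small(2) by (simp add: field_simps)
      then show "emeasure lborel ?F \<le> ennreal (\<epsilon> / 2 / 2 ^ m)"
        using emeasure_fine_holes[of c m r] c by (meson ennreal_leI order_trans less_imp_le)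
    qed (use \<open>\<epsilon> > 0\<close> in simp)
    also have "\<dots> = ennreal (\<epsilon> / 2 ^ m)"
      using \<open>\<epsilon> > 0\<close> by (simp flip: ennreal_plus)
    finally show ?thesis .
  qed
  then show ?thesis by blast
qed

section \<open>Densities of the complement of the holes\<close>

lemma dyadic_intervals_eq: "dyadic_intervals = {cell m r | m r. True}"
  unfolding dyadic_intervals_def cell_def by blast

lemma measure_cell: "measure lebesgue (cell m r) = 1 / 2 ^ m"
  by (simp add: cell_def divide_right_mono flip: diff_divide_distrib)

lemma emeasure_cell: "emeasure lborel (cell m r) = ennreal (1 / 2 ^ m)"
  by (simp add: cell_def divide_right_mono flip: diff_divide_distrib)

lemma cell_subset_cball:
  assumes "z \<in> cell m r"
  shows "cell m r \<subseteq> {z - 1 / 2 ^ m .. z + 1 / 2 ^ m}"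
  using assms by (auto simp: cell_def add_divide_distrib)

text \<open>Cells have positive length, which turns the one-sided neighbourhood of 0 into the single
  bound \<delta>.\<close>

lemma eventually_dyadic_cell_iff:
  "eventually P (inf (filtercomap (measure lebesgue) (at_right 0))
      (principal {I \<in> dyadic_intervals. z \<in> I})) \<longleftrightarrow>
   (\<exists>\<delta>>0. \<forall>m r. z \<in> cell m r \<longrightarrow> (1 / 2 ^ m :: real) < \<delta> \<longrightarrow> P (cell m r))"
proof
  assume "eventually P (inf (filtercomap (measure lebesgue) (at_right 0))
      (principal {I \<in> dyadic_intervals. z \<in> I}))"
  then obtain \<delta> where "\<delta> > 0"
    and P: "\<And>I. I \<in> dyadic_intervals \<Longrightarrow> z \<in> I \<Longrightarrow> 0 < measure lebesgue I \<Longrightarrow>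
      measure lebesgue I < \<delta> \<Longrightarrow> P I"
    unfolding eventually_inf_principal eventually_filtercomap eventually_at_right_field by fast
  have "P (cell m r)" if "z \<in> cell m r" "1 / 2 ^ m < \<delta>" for m r
    using that by (intro P) (auto simp: dyadic_intervals_eq measure_cell)
  then show "\<exists>\<delta>>0. \<forall>m r. z \<in> cell m r \<longrightarrow> (1 / 2 ^ m :: real) < \<delta> \<longrightarrow> P (cell m r)"
    using \<open>\<delta> > 0\<close> by blast
next
  assume "\<exists>\<delta>>0. \<forall>m r. z \<in> cell m r \<longrightarrow> (1 / 2 ^ m :: real) < \<delta> \<longrightarrow> P (cell m r)"
  then obtain \<delta> where "\<delta> > 0" "\<And>m r. z \<in> cell m r \<Longrightarrow> (1 / 2 ^ m :: real) < \<delta> \<Longrightarrow> P (cell m r)"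
    by blast
  then show "eventually P (inf (filtercomap (measure lebesgue) (at_right 0))
      (principal {I \<in> dyadic_intervals. z \<in> I}))"
    unfolding eventually_inf_principal eventually_filtercomap eventually_at_right_field
    by (intro exI[of _ "\<lambda>x. x < \<delta>"]) (auto simp: dyadic_intervals_eq measure_cell)
qed

lemma ex_cell: "\<exists>r. z \<in> cell m r"
proof
  have "of_int \<lfloor>z * 2 ^ m\<rfloor> \<le> z * 2 ^ m" "z * 2 ^ m \<le> of_int \<lfloor>z * 2 ^ m\<rfloor> + 1"
    by linarith+
  then show "z \<in> cell m \<lfloor>z * 2 ^ m\<rfloor>"
    by (simp add: cell_def field_simps)
qed

lemma lower_dyadic_density_le_1: "lower_dyadic_density C z \<le> 1"
  unfolding lower_dyadic_density_def
proof (rule Liminf_le)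
  show "\<forall>\<^sub>F I in inf (filtercomap (measure lebesgue) (at_right 0)) (principal {I \<in> dyadic_intervals. z \<in> I}).
      ereal (measure lebesgue (I \<inter> C) / measure lebesgue I) \<le> 1"
    unfolding eventually_dyadic_cell_iff
  proof (intro exI[of _ 1] conjI allI impI)
    fix m r
    \<comment> \<open>\<open>C\<close> is arbitrary here; a non-measurable set has measure 0 by
      default.\<close>
    have "measure lebesgue (cell m r \<inter> C) \<le> measure lebesgue (cell m r)"
    proof (cases "cell m r \<inter> C \<in> sets lebesgue")
      case True
      then show ?thesis
        by (intro measure_mono_fmeasurable) (auto simp: cell_def)
    qed (simp add: measure_notin_sets)
    then show "ereal (measure lebesgue (cell m r \<inter> C) / measure lebesgue (cell m r)) \<le> 1"
      by (simp add: measure_cell field_simps)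
  qed simp
  \<comment> \<open>The filter is proper because z lies in cells of every level; along
    \<open>bot\<close> the \<open>Liminf\<close> would be \<infinity>.\<close>
  show "inf (filtercomap (measure lebesgue) (at_right 0)) (principal {I \<in> dyadic_intervals. z \<in> I}) \<noteq> bot"
    unfolding trivial_limit_def eventually_dyadic_cell_iff
  proof safe
    fix \<delta> :: real
    assume "\<delta> > 0" and *: "\<forall>m r. z \<in> cell m r \<longrightarrow> 1 / 2 ^ m < \<delta> \<longrightarrow> False"
    then obtain m where "(1/2) ^ m < \<delta>"
      using real_arch_pow_inv[of \<delta> "1/2"] by auto
    then show False
      using * ex_cell[of z m] by (auto simp: power_one_over)
  qed
qed

text \<open>Near z a cell is covered by C, the holes of parameter c and a null set. As z avoids the
  larger holes of parameter d, \<open>holes_density\<close> makes the share of the holes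
  negligible.\<close>

lemma lower_dyadic_density_eq_1:
  assumes C: "closed C" and c: "0 < c" "c < d" "d \<le> 1/4"
    and z: "z \<notin> holes d" "z \<notin> dyadic_rationals" "z \<in> {a<..<b}"
    and sub: "{a<..<b} - holes c - C \<subseteq> dyadic_rationals"
  shows "lower_dyadic_density C z = 1"
proof (rule antisym[OF lower_dyadic_density_le_1])
  show "1 \<le> lower_dyadic_density C z"
    unfolding lower_dyadic_density_def le_Liminf_iff
  proof (intro allI impI)
    fix y :: ereal assume "y < 1"
    then obtain t where t: "y < ereal t" "t < 1"
      using ereal_dense2[of y 1] by (auto simp: one_ereal_def)
    obtain m\<^sub>0 where m0: "\<And>m r. m \<ge> m\<^sub>0 \<Longrightarrow> z \<in> cell m r \<Longrightarrow>
        emeasure lborel (cell m r \<inter> holes c) \<le> ennreal ((1 - t) / 2 ^ m)"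
      using holes_density[OF c z(1,2), of "1 - t"] t(2) by auto
    define \<delta> where "\<delta> = min (1 / 2 ^ m\<^sub>0) (min (z - a) (b - z))"
    have "\<delta> > 0"
      using z(3) by (auto simp: \<delta>_def)
    moreover have "y < ereal (measure lebesgue (cell m r \<inter> C) / measure lebesgue (cell m r))"
      if zr: "z \<in> cell m r" and m: "1 / 2 ^ m < \<delta>" for m r
    proof -
      have "1 / 2 ^ m < (1 / 2 ^ m\<^sub>0 :: real)"
        using m by (simp add: \<delta>_def)
      then have "m \<ge> m\<^sub>0"
        by (simp add: field_simps)
      define \<mu> where "\<mu> = measure lebesgue (cell m r \<inter> C)"
      have meas: "cell m r \<inter> C \<in> sets lborel" "cell m r \<inter> holes c \<in> sets lborel"
        using C open_holes[of c] by (auto simp: cell_def)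
      have fin: "emeasure lborel (cell m r \<inter> C) = ennreal \<mu>"
      proof -
        have "emeasure lborel (cell m r \<inter> C) \<le> emeasure lborel (cell m r)"
          by (intro emeasure_mono) (auto simp: cell_def)
        then have "emeasure lborel (cell m r \<inter> C) \<noteq> \<infinity>"
          unfolding emeasure_cell infinity_ennreal_def by (rule neq_top_trans[OF ennreal_neq_top])
        then show ?thesis
          using meas(1) by (simp add: \<mu>_def emeasure_eq_ennreal_measure)
      qed
      have D: "dyadic_rationals \<in> null_sets lborel"
        by (intro countable_imp_null_set_lborel countable_dyadic_rationals)
      have "cell m r \<subseteq> {a<..<b}"
        using cell_subset_cball[OF zr] m by (force simp: \<delta>_def)
      then have "cell m r \<subseteq> ((cell m r \<inter> C) \<union> (cell m r \<inter> holes c)) \<union> dyadic_rationals"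
        using sub by blast
      then have "emeasure lborel (cell m r) \<le> emeasure lborel (((cell m r \<inter> C) \<union> (cell m r \<inter> holes c)) \<union> dyadic_rationals)"
        using meas null_setsD2[OF D] by (meson emeasure_mono sets.Un)
      also have "\<dots> = emeasure lborel ((cell m r \<inter> C) \<union> (cell m r \<inter> holes c))"
        using meas by (intro emeasure_Un_null_set D sets.Un)
      also have "\<dots> \<le> emeasure lborel (cell m r \<inter> C) + emeasure lborel (cell m r \<inter> holes c)"
        using meas by (intro emeasure_subadditive)
      also have "\<dots> \<le> ennreal \<mu> + ennreal ((1 - t) / 2 ^ m)"
        unfolding fin using m0[OF \<open>m \<ge> m\<^sub>0\<close> zr] by (rule add_left_mono)
      also have "\<dots> = ennreal (\<mu> + (1 - t) / 2 ^ m)"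
        using t(2) by (simp add: \<mu>_def)
      finally have "1 / 2 ^ m \<le> \<mu> + (1 - t) / 2 ^ m"
        using t(2) unfolding emeasure_cell by (subst (asm) ennreal_le_iff) (auto simp: \<mu>_def)
      then have "t \<le> \<mu> / (1 / 2 ^ m)"
        by (simp add: field_simps)
      then show ?thesis
        using t(1) unfolding measure_cell \<mu>_def by (meson ereal_less_eq(3) less_le_trans)
    qed
    ultimately show "\<forall>\<^sub>F I in inf (filtercomap (measure lebesgue) (at_right 0)) (principal {I \<in> dyadic_intervals. z \<in> I}).
        y < ereal (measure lebesgue (I \<inter> C) / measure lebesgue I)"
      unfolding eventually_dyadic_cell_iff by blast
  qed
qed

text \<open>With p = q / 2^n and h = c^(n+1), the interval [p - h, p + 2h] contains z and loses its
  first third to a hole, so ratios of at most 2/3 occur at arbitrarily small scales.\<close>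

lemma lower_density_holes_neq_1:
  assumes "c > 0" "c < 1"
    and near: "\<And>k. \<exists>n\<ge>k. \<exists>q. real_of_int q / 2 ^ n < z \<and> z < real_of_int q / 2 ^ n + c ^ Suc n"
  shows "lower_density (- holes c) z \<noteq> 1"
proof
  let ?f = "\<lambda>(\<gamma>, \<delta>). ereal (measure lebesgue ({z - \<gamma> .. z + \<delta>} \<inter> - holes c) / (\<gamma> + \<delta>))"
  assume "lower_density (- holes c) z = 1"
  then have "ereal (2/3) < Liminf (at_right 0 \<times>\<^sub>F at_right 0) ?f"
    by (simp add: lower_density_def)
  from less_LiminfD[OF this] obtain b\<^sub>1 b\<^sub>2 where b: "b\<^sub>1 > 0" "b\<^sub>2 > 0"
    and large: "\<And>\<gamma> \<delta>. 0 < \<gamma> \<Longrightarrow> \<gamma> < b\<^sub>1 \<Longrightarrow> 0 < \<delta> \<Longrightarrow> \<delta> < b\<^sub>2 \<Longrightarrow> ereal (2/3) < ?f (\<gamma>, \<delta>)"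
    unfolding eventually_prod_filter eventually_at_right_field by blast
  \<comment> \<open>Both parts into which z divides the interval are shorter than 2h, whence the
    half.\<close>
  obtain k where k: "c ^ k < min b\<^sub>1 b\<^sub>2 / 2"
    using real_arch_pow_inv[of "min b\<^sub>1 b\<^sub>2 / 2" c] b assms by auto
  obtain n q where "n \<ge> k" and q: "real_of_int q / 2 ^ n < z" "z < real_of_int q / 2 ^ n + c ^ Suc n"
    using near by blast
  define p h where "p = real_of_int q / 2 ^ n" and "h = c ^ Suc n"
  have "h \<le> c ^ k"
    unfolding h_def using assms \<open>n \<ge> k\<close> by (intro power_decreasing) auto
  then have h: "0 < h" "2 * h < b\<^sub>1" "2 * h < b\<^sub>2"
    using k assms by (auto simp: h_def)
  have "{p - h .. p + 2 * h} \<inter> - holes c \<subseteq> {p - h} \<union> {p .. p + 2 * h}"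
  proof -
    have "{p - h <..< p} \<subseteq> holes c"
      by (auto simp: holes_def hole_def p_def h_def)
    then show ?thesis by force
  qed
  then have "measure lebesgue ({p - h .. p + 2 * h} \<inter> - holes c) \<le> measure lebesgue ({p - h} \<union> {p .. p + 2 * h})"
    using open_holes[of c] by (intro measure_mono_fmeasurable fmeasurable.Un) (auto intro: lmeasurable_compact)
  also have "\<dots> \<le> measure lebesgue {p - h} + measure lebesgue {p .. p + 2 * h}"
    by (intro measure_Un_le) auto
  also have "\<dots> = 2 * h"
    using h by simp
  finally have "measure lebesgue ({p - h .. p + 2 * h} \<inter> - holes c) / (3 * h) \<le> 2 / 3"
    using h by (simp add: field_simps)
  moreover have "ereal (2/3) < ?f (z - p + h, p + 2 * h - z)"
    using q h by (intro large) (auto simp: p_def h_def)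
  then have "2/3 < measure lebesgue ({p - h .. p + 2 * h} \<inter> - holes c) / (3 * h)"
    by (simp add: algebra_simps)
  ultimately show False by simp
qed

section \<open>The generic point\<close>

text \<open>On [0, 1/4] the map x -> x^(n+1) is 1-Lipschitz, so a single bound on d - c controls the
  growth of the holes of all levels.\<close>

lemma power_Suc_diff_le:
  assumes "0 \<le> c" "c \<le> d" "d \<le> (1/4 :: real)"
  shows "d ^ Suc n - c ^ Suc n \<le> d - c"
proof (induction n)
  case (Suc n)
  have "d ^ Suc (Suc n) - c ^ Suc (Suc n) = d * (d ^ Suc n - c ^ Suc n) + c ^ Suc n * (d - c)"
    by (simp add: algebra_simps)
  also have "\<dots> \<le> 1/4 * (d - c) + 1/4 * (d - c)"
  proof (intro add_mono mult_mono Suc.IH)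
    show "c ^ Suc n \<le> 1/4"
      using power_decreasing[of 1 "Suc n" c] assms by simp
    show "0 \<le> d ^ Suc n - c ^ Suc n"
      using power_mono[of c d "Suc n"] assms by simp
  qed (use assms in auto)
  also have "\<dots> \<le> d - c"
    using assms by simp
  finally show ?case .
qed simp

text \<open>The point \<open>x\<close> certifies that \<open>p = q / 2 ^ n\<close>, its dyadic approximation from below, is not within reach
  of a hole of a level at most \<open>n\<close> with a larger right endpoint: such a hole lies beyond \<open>x\<close>. The gap
  between \<open>p\<close> and \<open>x\<close> leaves room for increasing \<open>c\<close>.\<close>

lemma approach_hole:
  assumes c: "0 \<le> c" "c < 1/4" and "\<eta> > 0" and x: "open G" "x \<in> G" "x \<notin> holes c" "x \<notin> dyadic_rationals"
  shows "\<exists>n\<ge>k. \<exists>q a b d. c < d \<and> d < 1/4 \<and> {a..b} \<subseteq> G \<and> a < b \<and>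
     {a..b} \<subseteq> {real_of_int q / 2 ^ n .. real_of_int q / 2 ^ n + \<eta> ^ Suc n} \<and>
     (\<exists>y\<in>{a<..<b}. y \<notin> holes d \<and> y \<notin> dyadic_rationals)"
proof -
  obtain e where e: "e > 0" "ball x e \<subseteq> G"
    using x(1,2) openE by blast
  obtain n\<^sub>0 where n0: "(1/2) ^ n\<^sub>0 < e"
    using real_arch_pow_inv[of e "1/2"] e by auto
  define n where "n = max k n\<^sub>0"
  have n: "1 / 2 ^ n < e"
    using n0 power_decreasing[of n\<^sub>0 n "1/2 :: real"] by (simp add: n_def power_one_over)
  define q where "q = \<lfloor>x * 2 ^ n\<rfloor>"
  define p where "p = real_of_int q / 2 ^ n"
  have "p \<noteq> x"
    using x(4) dyadic_rationalsI[of q n] by (auto simp: p_def)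
  moreover have "real_of_int q \<le> x * 2 ^ n" "x * 2 ^ n < real_of_int q + 1"
    unfolding q_def by linarith+
  ultimately have px: "p < x" "x < p + 1 / 2 ^ n"
    by (auto simp: p_def field_simps)
  \<comment> \<open>Half of the gap between p and x is reserved for the growth of the holes, the
    other half for the new interval [p, p + 2^-M].\<close>
  define d where "d = min ((c + 1/4) / 2) (c + (x - p) / 2)"
  have d: "c < d" "d < 1/4" "d - c \<le> (x - p) / 2"
    using c px by (auto simp: d_def min_def field_simps)
  obtain M\<^sub>0 where M0: "(1/2) ^ M\<^sub>0 < min (\<eta> ^ Suc n) ((x - p) / 2)"
    using real_arch_pow_inv[of "min (\<eta> ^ Suc n) ((x - p) / 2)" "1/2"] px \<open>\<eta> > 0\<close> by auto
  define M where "M = max n M\<^sub>0"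
  have M: "1 / 2 ^ M < \<eta> ^ Suc n" "1 / 2 ^ M < (x - p) / 2" "n \<le> M"
    using M0 power_decreasing[of M\<^sub>0 M "1/2 :: real"] by (auto simp: M_def power_one_over)
  define r where "r = q * 2 ^ (M - n)"
  have "(2::real) ^ M = 2 ^ n * 2 ^ (M - n)"
    using M(3) by (metis le_add_diff_inverse power_add)
  then have r: "real_of_int r / 2 ^ M = p" "(real_of_int r + 1) / 2 ^ M = p + 1 / 2 ^ M"
    by (simp_all add: r_def p_def add_divide_distrib)
  have "cell M r \<inter> hole d l s = {}" if "l < M" for l s
  proof (cases "real_of_int s / 2 ^ l \<le> p")
    case True
    then show ?thesis
      by (auto simp: cell_def hole_def r)
  next
    case False
    define t where "t = real_of_int s / 2 ^ l"
    have "p + 1 / 2 ^ M \<le> t - d ^ Suc l"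
    proof (cases "l \<le> n")
      \<comment> \<open>No grid point of level l lies strictly between p and p + 2^-n, so the hole
        ends beyond x; as it avoids x, it also starts there or later. Widening uses at most half of
        the gap back to p.\<close>
      case True
      then have "p + 1 / 2 ^ n \<le> t"
        using dyadic_gap[of l n q s] False by (simp add: p_def t_def add_divide_distrib)
      moreover have "x \<notin> hole c l s"
        using x(3) by (auto simp: holes_def)
      ultimately have "x \<le> t - c ^ Suc l"
        using px by (auto simp: hole_def t_def)
      moreover have "d ^ Suc l - c ^ Suc l \<le> d - c"
        using c d by (intro power_Suc_diff_le) auto
      ultimately show ?thesis
        using d(3) M(2) by argo
    next
      \<comment> \<open>The next grid point after p is 2^-l away. The hole covers at most half of
        this distance, and the cell at most the other half since l < M.\<close>
      case nl: False
      define s' where "s' = q * 2 ^ (l - n)"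
      have "(2::real) ^ l = 2 ^ n * 2 ^ (l - n)"
        using nl by (metis le_add_diff_inverse nat_le_linear power_add)
      then have s': "real_of_int s' / 2 ^ l = p"
        by (simp add: s'_def p_def)
      then have "p + 1 / 2 ^ l \<le> t"
        using dyadic_gap[of l l s' s] False by (simp add: t_def add_divide_distrib)
      moreover have "d ^ Suc l \<le> 1 / 2 ^ l / 2"
      proof -
        have "d ^ Suc l \<le> 1 / 2 ^ l / 2 ^ l / 4"
          using c d by (intro power_quarter_le) auto
        also have "1 \<le> 2 * (2::real) ^ l"
          using one_le_power[of "2::real" l] by linarith
        then have "1 / 2 ^ l / 2 ^ l / 4 \<le> (1 / 2 ^ l / 2 :: real)"
          by (simp add: field_simps)
        finally show ?thesis .
      qed
      moreover have "1 / 2 ^ M \<le> (1 / 2 ^ l / 2 :: real)"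
        using power_decreasing[of "Suc l" M "1/2 :: real"] that by (simp add: power_one_over)
      ultimately show ?thesis by linarith
    qed
    then show ?thesis
      unfolding t_def by (auto simp: cell_def hole_def r)
  qed
  then have "\<exists>y\<in>{p<..<p + 1 / 2 ^ M}. y \<notin> holes d \<and> y \<notin> dyadic_rationals"
    using exists_point_outside_holes[of d M r] c d by (simp add: r)
  moreover have "{p..p + 1 / 2 ^ M} \<subseteq> G"
  proof -
    have "{p..p + 1 / 2 ^ M} \<subseteq> ball x e"
      using px M n by (auto simp: ball_def dist_real_def)
    then show ?thesis using e by blast
  qed
  ultimately show ?thesis
    using d M by (intro exI[of _ n] conjI exI[of _ q] exI[of _ p] exI[of _ "p + 1 / 2 ^ M"] exI[of _ d])
      (auto simp: p_def n_def)
qed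

text \<open>A triple (a, b, c) stands for the points of \<open>{a<..<b}\<close> outside
  \<open>holes c\<close>. Stage k settles C k and moves just to the right of a dyadic rational of
  level at least k; compactness yields the limit.\<close>

lemma generic_point:
  assumes C: "\<And>i :: nat. closed (C i :: real set)"
  obtains z where "z \<in> {0..1}" "z \<notin> holes (1/8)"
    "\<And>k. \<exists>n\<ge>k. \<exists>q. real_of_int q / 2 ^ n < z \<and> z < real_of_int q / 2 ^ n + (1/8) ^ Suc n"
    "\<And>i. z \<in> C i \<Longrightarrow> lower_dyadic_density (C i) z = 1"
proof -
  \<comment> \<open>The point x lets the next stage start, and c < 1/4 leaves room to increase
    c.\<close>
  define P :: "nat \<Rightarrow> real \<times> real \<times> real \<Rightarrow> bool" where
    "P k = (\<lambda>(a, b, c). 0 \<le> a \<and> b \<le> 1 \<and> 1/8 \<le> c \<and> c < 1/4 \<and>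
       (\<exists>x\<in>{a<..<b}. x \<notin> holes c \<and> x \<notin> dyadic_rationals))" for k
  define Q :: "nat \<Rightarrow> real \<times> real \<times> real \<Rightarrow> real \<times> real \<times> real \<Rightarrow> bool" where
    "Q k = (\<lambda>(a, b, c) (a', b', c'). {a'..b'} \<subseteq> {a<..<b} \<and> c < c' \<and>
       (\<exists>n\<ge>k. \<exists>q. {a'..b'} \<subseteq> {real_of_int q / 2 ^ n .. real_of_int q / 2 ^ n + (1/8) ^ Suc n}) \<and>
       ({a'..b'} \<inter> C k = {} \<or> {a<..<b} - holes c - C k \<subseteq> dyadic_rationals))" for k
  have "\<exists>s. \<forall>k. P k (s k) \<and> Q k (s k) (s (Suc k))"
  proof (rule dependent_nat_choice)
    have "\<exists>y\<in>{0<..<1}. y \<notin> holes (1/8) \<and> y \<notin> dyadic_rationals"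
      using exists_point_outside_holes[of "1/8" 0 0] by simp
    then show "\<exists>s. P 0 s"
      unfolding P_def by (intro exI[of _ "(0, 1, 1/8)"]) auto
  next
    fix s k assume "P k s"
    then obtain a b c x where s: "s = (a, b, c)" and abc: "0 \<le> a" "b \<le> 1" "1/8 \<le> c" "c < 1/4"
      and x: "x \<in> {a<..<b}" "x \<notin> holes c" "x \<notin> dyadic_rationals"
      unfolding P_def by (cases s) auto
    \<comment> \<open>If C k does not contain the current set up to dyadic rationals, removing C k
      leaves an open set with a non-dyadic point outside the holes.\<close>
    define G where "G = (if {a<..<b} - holes c - C k \<subseteq> dyadic_rationals then {a<..<b} else {a<..<b} - C k)"
    have "open G"
      using C by (auto simp: G_def open_Diff)
    have "\<exists>x\<in>G. x \<notin> holes c \<and> x \<notin> dyadic_rationals"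
      unfolding G_def using x by auto
    then obtain x' where x': "x' \<in> G" "x' \<notin> holes c" "x' \<notin> dyadic_rationals" by blast
    have "0 \<le> c" "(0 :: real) < 1/8"
      using abc by auto
    from approach_hole[OF this(1) abc(4) this(2) \<open>open G\<close> x', of k]
    obtain n q a' b' d where step: "n \<ge> k" "c < d" "d < 1/4" "{a'..b'} \<subseteq> G" "a' < b'"
      "{a'..b'} \<subseteq> {real_of_int q / 2 ^ n .. real_of_int q / 2 ^ n + (1/8) ^ Suc n}"
      "\<exists>y\<in>{a'<..<b'}. y \<notin> holes d \<and> y \<notin> dyadic_rationals"
      by blast
    have "{a'..b'} \<subseteq> {a<..<b}"
      using step(4) by (auto simp: G_def split: if_splits)
    moreover from this have "a < a'" "b' < b"
      using step(5) by (auto simp: subset_iff)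
    moreover have "{a'..b'} \<inter> C k = {} \<or> {a<..<b} - holes c - C k \<subseteq> dyadic_rationals"
      using step(4) by (auto simp: G_def split: if_splits)
    ultimately show "\<exists>s'. P (Suc k) s' \<and> Q k s s'"
      using step abc unfolding P_def Q_def s by (intro exI[of _ "(a', b', d)"]) auto
  qed
  then obtain s where "\<And>k. P k (s k)" and "\<And>k. Q k (s k) (s (Suc k))" by blast
  define a b c where "a k = fst (s k)" and "b k = fst (snd (s k))" and "c k = snd (snd (s k))" for k
  have s: "s k = (a k, b k, c k)" for k
    by (simp add: a_def b_def c_def)
  have bounds: "0 \<le> a k" "b k \<le> 1" "1/8 \<le> c k" "c k < 1/4"
    and pt: "\<exists>x\<in>{a k<..<b k}. x \<notin> holes (c k)" for k
    using \<open>P k (s k)\<close> by (auto simp: P_def s)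
  have nest: "{a (Suc k)..b (Suc k)} \<subseteq> {a k<..<b k}" "c k < c (Suc k)"
    and near: "\<exists>n\<ge>k. \<exists>q. {a (Suc k)..b (Suc k)} \<subseteq> {real_of_int q / 2 ^ n .. real_of_int q / 2 ^ n + (1/8) ^ Suc n}"
    and decide: "{a (Suc k)..b (Suc k)} \<inter> C k = {} \<or> {a k<..<b k} - holes (c k) - C k \<subseteq> dyadic_rationals" for k
    using \<open>Q k (s k) (s (Suc k))\<close> by (auto simp: Q_def s)
  \<comment> \<open>Closed intervals minus open holes are compact, and they decrease because the
    intervals shrink and the holes grow with c.\<close>
  define F where "F k = {a k..b k} - holes (c k)" for k
  have "\<Inter> (range F) \<noteq> {}"
  proof (rule compact_nest)
    show "compact (F k)" for k
      unfolding F_def by (intro compact_diff open_holes) simp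
    show "F k \<noteq> {}" for k
    proof -
      obtain x where "x \<in> {a k<..<b k}" "x \<notin> holes (c k)"
        using pt by blast
      then have "x \<in> F k" by (simp add: F_def)
      then show ?thesis by blast
    qed
    have "F (Suc k) \<subseteq> F k" for k
      using nest[of k] holes_mono[of "c k" "c (Suc k)"] bounds[of k] by (force simp: F_def)
    then show "F l \<subseteq> F k" if "k \<le> l" for k l
      using that by (rule lift_Suc_antimono_le)
  qed
  then obtain z where "\<And>k. z \<in> F k" by blast
  then have z: "z \<in> {a k..b k}" "z \<notin> holes (c k)" for k
    by (auto simp: F_def)
  have z': "z \<in> {a k<..<b k}" for k
    using z(1)[of "Suc k"] nest(1)[of k] by blast
  have near': "\<exists>n\<ge>k. \<exists>q. real_of_int q / 2 ^ n < z \<and> z < real_of_int q / 2 ^ n + (1/8) ^ Suc n" for k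
  proof -
    obtain n q where "n \<ge> k" and
      sub: "{a (Suc k)..b (Suc k)} \<subseteq> {real_of_int q / 2 ^ n .. real_of_int q / 2 ^ n + (1/8) ^ Suc n}"
      using near by blast
    have "a (Suc k) < z" "z < b (Suc k)"
      using z'[of "Suc k"] by auto
    moreover from this sub have "real_of_int q / 2 ^ n \<le> a (Suc k)"
      "b (Suc k) \<le> real_of_int q / 2 ^ n + (1/8) ^ Suc n"
      by (auto simp: subset_iff)
    ultimately show ?thesis
      using \<open>n \<ge> k\<close> by (meson le_less_trans less_le_trans)
  qed
  \<comment> \<open>A dyadic rational of level at most n to the right of q / 2^n is at least 2^-n
    away from it, too far for \<open>near'\<close>.\<close>
  have nd: "z \<notin> dyadic_rationals"
  proof
    assume "z \<in> dyadic_rationals"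
    then obtain s l where zl: "z = real_of_int s / 2 ^ l"
      by (auto simp: dyadic_rationals_def)
    obtain n q where "n \<ge> l" and nq: "real_of_int q / 2 ^ n < z" "z < real_of_int q / 2 ^ n + (1/8) ^ Suc n"
      using near' by blast
    have "real_of_int q / 2 ^ n + 1 / 2 ^ n \<le> z"
      using dyadic_gap[of l n q s] \<open>n \<ge> l\<close> nq zl by (simp add: add_divide_distrib)
    moreover have "(1/8) ^ Suc n \<le> (1 / 2 ^ n :: real)"
    proof -
      have "(1/8) ^ Suc n \<le> (1/8 :: real) ^ n" by simp
      also have "\<dots> \<le> (1/2) ^ n" by (intro power_mono) auto
      finally show ?thesis by (simp add: power_one_over)
    qed
    ultimately show False
      using nq by linarith
  qed
  show ?thesis
  proof (rule that)
    show "z \<in> {0..1}"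
      using z(1)[of 0] bounds[of 0] by auto
    show "z \<notin> holes (1/8)"
      using z(2)[of 0] holes_mono[of "1/8" "c 0"] bounds[of 0] by auto
    \<comment> \<open>Membership in C i rules out the first alternative of \<open>decide\<close>;
      the parameter of the next stage serves as d.\<close>
    show "lower_dyadic_density (C i) z = 1" if "z \<in> C i" for i
    proof (rule lower_dyadic_density_eq_1)
      show "{a i<..<b i} - holes (c i) - C i \<subseteq> dyadic_rationals"
        using decide[of i] z(1)[of "Suc i"] that by blast
      show "z \<notin> holes (c (Suc i))" "c (Suc i) \<le> 1/4" "0 < c i" "c i < c (Suc i)"
        using z bounds[of i] bounds[of "Suc i"] nest(2)[of i] by auto
    qed (fact nd z' C)+
  qed (fact near')
qed

section \<open>Effectively closed classes\<close>

text \<open>With \<open>p = 2 ^ n\<close>, the endpoints of \<open>hole (1/8) n (a' - b')\<close> are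
  \<open>(a' - b') / p\<close> and \<open>(8 p\<^sup>2 (a' - b') - 1) / (8 p\<^sup>3)\<close>.\<close>

definition hole_code :: "nat \<Rightarrow> nat list \<Rightarrow> bool" where
  "hole_code n xs \<longleftrightarrow>
     xs ! 0 = 2 ^ (n + n + 3) * xs ! 3 \<and> xs ! 1 = Suc (2 ^ (n + n + 3) * xs ! 4) \<and>
     Suc (xs ! 2) = 2 ^ (n + n + 3) * 2 ^ n \<and> Suc (xs ! 5) = 2 ^ n"

text \<open>\<open>Mu\<close> searches for the level n; the four equations hold together exactly
  when the sum of the four distances is 0.\<close>

lemma computably_enumerable_hole_code:
  "computably_enumerable 6 {xs. length xs = 6 \<and> (\<exists>n. hole_code n xs)}"
proof -
  define K where
    "K = Comp rec_pow2 [Comp rec_add [Comp rec_add [Proj 0, Proj 0],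
       Comp Succ [Comp Succ [Comp Succ [Zero]]]]]"
  define P where "P = Comp rec_pow2 [Proj 0]"
  \<comment> \<open>The searched n comes first, so \<open>Proj (Suc i)\<close> reads entry i of the
    tuple.\<close>
  define f where
    "f = Comp rec_add [Comp rec_add [Comp rec_dist [Proj 1, Comp rec_mult [K, Proj 4]],
           Comp rec_dist [Proj 2, Comp Succ [Comp rec_mult [K, Proj 5]]]],
         Comp rec_add [Comp rec_dist [Comp Succ [Proj 3], Comp rec_mult [K, P]],
           Comp rec_dist [Comp Succ [Proj 6], P]]]"
  define d :: "nat \<Rightarrow> nat \<Rightarrow> nat" where "d x y = (y - x) + (x - y)" for x y
  note dist = rec_eval_dist[folded d_def]
  have d0: "d x y = 0 \<longleftrightarrow> x = y" for x y
    by (auto simp: d_def)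
  have ex: "(\<exists>y. rec_eval (Mu f) xs y) \<longleftrightarrow> (\<exists>n. hole_code n xs)" if len: "length xs = 6" for xs
  proof -
    define F where
      "F n = (d (xs ! 0) (2 ^ (n + n + 3) * xs ! 3) + d (xs ! 1) (Suc (2 ^ (n + n + 3) * xs ! 4)))
        + (d (Suc (xs ! 2)) (2 ^ (n + n + 3) * 2 ^ n) + d (Suc (xs ! 5)) (2 ^ n))" for n
    have "rec_eval f (n # xs) (F n)" for n
    proof -
      have proj: "rec_eval (Proj i) (n # xs) ((n # xs) ! i)" if "i < 7" for i
        using that len by (intro eval_Proj) simp
      have proj0: "rec_eval (Proj 0) (n # xs) n"
        and proj1: "rec_eval (Proj 1) (n # xs) (xs ! 0)"
        and proj2: "rec_eval (Proj 2) (n # xs) (xs ! 1)"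
        and proj3: "rec_eval (Proj 3) (n # xs) (xs ! 2)"
        and proj4: "rec_eval (Proj 4) (n # xs) (xs ! 3)"
        and proj5: "rec_eval (Proj 5) (n # xs) (xs ! 4)"
        and proj6: "rec_eval (Proj 6) (n # xs) (xs ! 5)"
        using proj[of 0] proj[of 1] proj[of 2] proj[of 3] proj[of 4] proj[of 5] proj[of 6]
        by simp_all
      have three: "rec_eval (Comp Succ [Comp Succ [Comp Succ [Zero]]]) (n # xs) 3"
        using rec_eval_Comp1[OF rec_eval_Comp1[OF rec_eval_Comp1[OF eval_Zero eval_Succ] eval_Succ]
            eval_Succ]
        by (simp add: numeral_3_eq_3)
      have K: "rec_eval K (n # xs) (2 ^ (n + n + 3))"
        unfolding K_def
        by (rule rec_eval_Comp1[OF rec_eval_Comp2[OF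
                rec_eval_Comp2[OF proj0 proj0 rec_eval_add] three rec_eval_add] rec_eval_pow2])
      have P: "rec_eval P (n # xs) (2 ^ n)"
        unfolding P_def by (rule rec_eval_Comp1[OF proj0 rec_eval_pow2])
      show ?thesis
        unfolding f_def F_def
        by (intro rec_eval_Comp2[OF _ _ rec_eval_add] rec_eval_Comp2[OF _ _ dist]
            rec_eval_Comp2[OF _ _ rec_eval_mult] rec_eval_Comp1[OF _ eval_Succ]
            K P proj1 proj2 proj3 proj4 proj5 proj6)
    qed
    from rec_eval_Mu_iff[OF this] show ?thesis
      by (simp add: F_def d0 hole_code_def)
  qed
  show ?thesis
    unfolding computably_enumerable_def using ex by (intro exI[of _ "Mu f"]) auto
qed

lemma hole_code_interval:
  assumes "hole_code n [a, b, c, a', b', c']"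
  shows "{rational_code a b c <..< rational_code a' b' c'} = hole (1/8) n (int a' - int b')"
proof -
  define p :: real where "p = 2 ^ n"
  have p: "p > 0" by (simp add: p_def)
  define k :: nat where "k = 2 ^ (n + n + 3)"
  have k: "real k = 8 * p\<^sup>2"
    unfolding k_def p_def power_add power2_eq_square by simp
  have "a = k * a'" "b = Suc (k * b')" "Suc c = k * 2 ^ n" "Suc c' = 2 ^ n"
    using assms unfolding hole_code_def k_def[symmetric] by simp_all
  then have eqs: "real a = 8 * p\<^sup>2 * a'" "real b = 8 * p\<^sup>2 * b' + 1"
    "real (Suc c) = 8 * p\<^sup>2 * p" "real (Suc c') = p"
    by (simp_all add: k p_def del: of_nat_Suc) (simp add: k p_def)
  have h: "(1/8::real) ^ Suc n = 1 / (8 * p\<^sup>2 * p)"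
  proof -
    have "(8::real) ^ n = p * p * p"
      unfolding p_def power_mult_distrib[symmetric] by simp
    then show ?thesis
      by (simp add: power_one_over power2_eq_square)
  qed
  have "(real a - real b) / real (Suc c) = (real a' - real b') / p - 1 / (8 * p\<^sup>2 * p)"
    unfolding eqs using p by (simp add: field_simps)
  then show ?thesis
    unfolding rational_code_def hole_def eqs(4) h by (simp add: p_def)
qed

lemma effectively_closed_holes: "effectively_closed (- holes (1/8))"
proof -
  have "x \<in> holes (1/8) \<longleftrightarrow> (\<exists>a b c a' b' c'. (\<exists>n. hole_code n [a, b, c, a', b', c']) \<and>
          rational_code a b c < x \<and> x < rational_code a' b' c')" for x
  proof
    assume "x \<in> holes (1/8)"
    then obtain n q where x: "x \<in> hole (1/8) n q"
      by (auto simp: holes_def)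
    define a' b' where "a' = nat q" and "b' = nat (- q)"
    have q: "int a' - int b' = q"
      by (simp add: a'_def b'_def)
    \<comment> \<open>The subtractions of 1 cancel the \<open>Suc\<close> in the denominators of
      \<open>rational_code\<close>; the powers are positive, so nothing is truncated.\<close>
    have "hole_code n [2 ^ (n + n + 3) * a', Suc (2 ^ (n + n + 3) * b'),
            2 ^ (n + n + 3) * 2 ^ n - 1, a', b', 2 ^ n - 1]"
      by (simp add: hole_code_def)
    then show "\<exists>a b c a' b' c'. (\<exists>n. hole_code n [a, b, c, a', b', c']) \<and>
          rational_code a b c < x \<and> x < rational_code a' b' c'"
      using x hole_code_interval q by (metis greaterThanLessThan_iff)
  next
    assume "\<exists>a b c a' b' c'. (\<exists>n. hole_code n [a, b, c, a', b', c']) \<and>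
          rational_code a b c < x \<and> x < rational_code a' b' c'"
    then show "x \<in> holes (1/8)"
      unfolding holes_def using hole_code_interval by (metis UN_iff UNIV_I greaterThanLessThan_iff)
  qed
  then show ?thesis
    unfolding effectively_closed_def effectively_open_def
    by (intro exI[of _ "{xs. length xs = 6 \<and> (\<exists>n. hole_code n xs)}"])
       (simp add: computably_enumerable_hole_code set_eq_iff)
qed

section \<open>Openness and countability\<close>

lemma effectively_open_imp_open:
  assumes "effectively_open U"
  shows "open U"
proof -
  from assms obtain A where U: "U = {x. \<exists>a b c a' b' c'. [a, b, c, a', b', c'] \<in> A \<and>
                 rational_code a b c < x \<and> x < rational_code a' b' c'}"
    by (auto simp: effectively_open_def)
  show ?thesis
    unfolding U by (intro open_Collect_ex open_Collect_conj open_Collect_const open_Collect_less continuous_intros)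
qed

text \<open>Each such class is determined by a code for its complement, and there are countably many
  codes.\<close>

lemma countable_effectively_closed: "countable {C. effectively_closed C}"
proof -
  define dom where "dom f = {xs. length xs = 6 \<and> (\<exists>y. rec_eval f xs y)}" for f
  define U where "U A = {x. \<exists>a b c a' b' c'. [a, b, c, a', b', c'] \<in> A \<and>
                 rational_code a b c < x \<and> x < rational_code a' b' c'}" for A
  have "C \<in> range (\<lambda>f. - U (dom f))" if C: "effectively_closed C" for C
  proof -
    obtain A where "computably_enumerable 6 A" and A: "- C = U A"
      using C unfolding effectively_closed_def effectively_open_def U_def by blast
    then obtain f where "A = dom f"
      unfolding computably_enumerable_def dom_def by blast
    with A have "- C = U (dom f)" by simp
    then have "C = - U (dom f)" by auto
    then show ?thesis by blast
  qed
  then have "{C. effectively_closed C} \<subseteq> range (\<lambda>f. - U (dom f))" by blast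
  then show ?thesis
    by (rule countable_subset) (intro countable_image countableI_type)
qed

theorem theorem11p2:
  "\<exists>z :: real. z \<in> {0..1} \<and> dyadic_density_one_point z \<and> \<not> density_one_point z"
proof -
  define C where "C = from_nat_into {C. effectively_closed C}"
  \<comment> \<open>Nonemptiness ensures that \<open>from_nat_into\<close> takes no value outside
    the family.\<close>
  have ne: "{C. effectively_closed C} \<noteq> {}"
    using effectively_closed_holes by blast
  have range_C: "range C = {C. effectively_closed C}"
    unfolding C_def using range_from_nat_into[OF ne countable_effectively_closed] .
  then have "closed (C i)" for i
    using effectively_open_imp_open by (auto simp: effectively_closed_def closed_def)
  then obtain z where z: "z \<in> {0..1}" "z \<notin> holes (1/8)"
    "\<And>k. \<exists>n\<ge>k. \<exists>q. real_of_int q / 2 ^ n < z \<and> z < real_of_int q / 2 ^ n + (1/8) ^ Suc n"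
    "\<And>i. z \<in> C i \<Longrightarrow> lower_dyadic_density (C i) z = 1"
    by (rule generic_point[of C]) blast
  have "dyadic_density_one_point z"
    unfolding dyadic_density_one_point_def using z(4) range_C by (metis mem_Collect_eq rangeE)
  moreover have "lower_density (- holes (1/8)) z \<noteq> 1"
    by (rule lower_density_holes_neq_1[OF _ _ z(3)]) auto
  then have "\<not> density_one_point z"
    unfolding density_one_point_def using effectively_closed_holes z(2) by blast
  ultimately show ?thesis
    using z(1) by blast
qed

end
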